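(* Consider an abelian group $P$ equipped with endomorphisms $\rho,\lambda,a_1,a_2,a_3$ such that $\{a_1,a_2,a_3\}$ is a complete set of orthogonal idempotents, $\rho\lambda=\lambda\rho=1_P=-\rho^3$, and $a_1=a_2^\rho$, $a_2=a_3^\rho$, $a_3=a_1^\rho$. Define $S_i=\mathrm{Im}\,a_i$ for $1\le i\le 3$, with the abelian group isomorphisms $\theta_1\colon S_1\to S_3$, $\theta_2\colon S_2\to S_1$, $\theta_3\colon S_3\to S_2$ obtained by restricting $\rho$. (a) The operations $$y_3/x_2=y_3\theta_1^{-1}+x_2\theta_2\in S_1,\qquad y_1\backslash x_3=y_1\theta_2^{-1}+x_3\theta_3\in S_2,\qquad x_1\cdot y_2=x_1\theta_1+y_2\theta_3^{-1}\in S_3$$ (for $x_i,y_i\in S_i$) define a reversible automaton on the triple $(S_1,S_2,S_3)$ of state spaces. (b) Let $A$ be an abelian group with $A\cong S_1\cong S_2\cong S_3$. The semisymmetrized algebra $(P,\cdot,\alpha)$ with $x\cdot y=x\rho+y\lambda$ and $(x_1,x_2,x_3)\alpha=x_1a_1+x_2a_2+x_3a_3$ is isomorphic to the semisymmetrization of a quasigroup isotopic to the abelian group $A$.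
   Context: Functions are written to the right of their arguments, so a composite $fg$ means first $f$, then $g$, and $a^\rho=\rho^{-1}a\rho$. "Complete set of orthogonal idempotents" means $a_1+a_2+a_3=1_P$, $a_i^2=a_i$, and $a_ia_j=0$ for $i\ne j$. Thus $P=S_1\oplus S_2\oplus S_3$, with elements written as triples $[x_1\ x_2\ x_3]$, $x_i\in S_i$. The maps $\theta_i$ are given by $$[x_1\ 0\ 0]\rho=[0\ 0\ x_1\theta_1],\quad [0\ x_2\ 0]\rho=[x_2\theta_2\ 0\ 0],\quad [0\ 0\ x_3]\rho=[0\ x_3\theta_3\ 0].$$ A reversible automaton (of quasigroup type) is a triple $(S_1,S_2,S_3)$ of sets (state spaces) with operations of multiplication $S_1\times S_2\to S_3$, $(x_1,x_2)\mapsto x_1\cdot x_2$, right division $S_3\times S_2\to S_1$, $(x_3,x_2)\mapsto x_3/x_2$, and left division $S_1\times S_3\to S_2$, $(x_1,x_3)\mapsto x_1\backslash x_3$, satisfying $x_1\backslash(x_1\cdot x_2)=x_2$, $x_1=(x_1\cdot x_2)/x_2$, $x_1\cdot(x_1\backslash x_3)=x_3$, $x_3=(x_3/x_2)\cdot x_2$. A quasigroup $(Q,\cdot,/,\backslash)$ is a set with three binary operations satisfying $x\cdot(x\backslash y)=y$, $y=(y/x)\cdot x$, $x\backslash(x\cdot y)=y$, $y=(y\cdot x)/x$. Quasigroups $Q,Q'$ are isotopic if there are bijections $f_1,f_2,f_3\colon Q\to Q'$ with $xf_1\cdot yf_2=(x\cdot y)f_3$ for all $x,y\in Q$. A quasigroup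 is semisymmetric if it satisfies $x\cdot yx=y$. A semisymmetrized algebra $(P,\cdot,\alpha)$ is a set with a binary operation (also written by juxtaposition) making $(P,\cdot)$ a semisymmetric quasigroup, and a ternary operation $\alpha$ satisfying $(x,x,x)\alpha=x$, $\big((x_{11},x_{12},x_{13})\alpha,(x_{21},x_{22},x_{23})\alpha,(x_{31},x_{32},x_{33})\alpha\big)\alpha=(x_{11},x_{22},x_{33})\alpha$, and $(x_1y_1,x_2y_2,x_3y_3)\alpha=(x_3,x_1,x_2)\alpha\cdot(y_2,y_3,y_1)\alpha$. With $x/\!/y=y/x$ and $x\backslash\!\backslash y=y\backslash x$, the semisymmetrization of a quasigroup $Q$ is the set $Q^3$ with multiplication $$(x_1,x_2,x_3)\cdot(y_1,y_2,y_3)=(x_2/\!/y_3,\ x_3\backslash\!\backslash y_1,\ x_1\cdot y_2),$$ which is a semisymmetric quasigroup; as a semisymmetrized algebra it carries the ternary operation $\big((x_1,x_2,x_3),(y_1,y_2,y_3),(z_1,z_2,z_3)\big)\alpha=(x_1,y_2,z_3)$. *)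

theory Defs
  imports "HOL-Algebra.Group"
begin

text \<open>
  The mathematics writes maps to the right of their arguments, so that the composite
  \<open>f g\<close> means first \<open>f\<close>, then \<open>g\<close>; here maps are applied on the left.  The additively written
  abelian groups are \<^locale>\<open>comm_group\<close>s, so \<open>+\<close>, \<open>0\<close>, \<open>-\<close> become \<open>\<otimes>\<close>, \<open>\<one>\<close>, \<open>inv\<close>.
\<close>

definition complete_orthogonal_idempotents ::
  "('p, 'm) monoid_scheme \<Rightarrow> ('p \<Rightarrow> 'p) \<Rightarrow> ('p \<Rightarrow> 'p) \<Rightarrow> ('p \<Rightarrow> 'p) \<Rightarrow> bool" where
  "complete_orthogonal_idempotents P a\<^sub>1 a\<^sub>2 a\<^sub>3 \<longleftrightarrow>
     (\<forall>x\<in>carrier P.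
        a\<^sub>1 x \<otimes>\<^bsub>P\<^esub> a\<^sub>2 x \<otimes>\<^bsub>P\<^esub> a\<^sub>3 x = x \<and>
        a\<^sub>1 (a\<^sub>1 x) = a\<^sub>1 x \<and> a\<^sub>2 (a\<^sub>2 x) = a\<^sub>2 x \<and> a\<^sub>3 (a\<^sub>3 x) = a\<^sub>3 x \<and>
        a\<^sub>1 (a\<^sub>2 x) = \<one>\<^bsub>P\<^esub> \<and> a\<^sub>1 (a\<^sub>3 x) = \<one>\<^bsub>P\<^esub> \<and>
        a\<^sub>2 (a\<^sub>1 x) = \<one>\<^bsub>P\<^esub> \<and> a\<^sub>2 (a\<^sub>3 x) = \<one>\<^bsub>P\<^esub> \<and>
        a\<^sub>3 (a\<^sub>1 x) = \<one>\<^bsub>P\<^esub> \<and> a\<^sub>3 (a\<^sub>2 x) = \<one>\<^bsub>P\<^esub>)"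

(* The conjugate of a by \<rho>, which is the composite, read from left to right, of the inverse of \<rho>,
   then a, then \<rho>.  The inverse is taken on the carrier X. *)
definition conj_by :: "'p set \<Rightarrow> ('p \<Rightarrow> 'p) \<Rightarrow> ('p \<Rightarrow> 'p) \<Rightarrow> 'p \<Rightarrow> 'p" where
  "conj_by X \<rho> a x = \<rho> (a (inv_into X \<rho> x))"

locale reversible_automaton =
  fixes S\<^sub>1 :: "'s set" and S\<^sub>2 :: "'t set" and S\<^sub>3 :: "'u set"
    and mul :: "'s \<Rightarrow> 't \<Rightarrow> 'u"
    and rdiv :: "'u \<Rightarrow> 't \<Rightarrow> 's"
    and ldiv :: "'s \<Rightarrow> 'u \<Rightarrow> 't"
  assumes mul_closed: "\<lbrakk>x\<^sub>1 \<in> S\<^sub>1; x\<^sub>2 \<in> S\<^sub>2\<rbrakk> \<Longrightarrow> mul x\<^sub>1 x\<^sub>2 \<in> S\<^sub>3"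
    and rdiv_closed: "\<lbrakk>x\<^sub>3 \<in> S\<^sub>3; x\<^sub>2 \<in> S\<^sub>2\<rbrakk> \<Longrightarrow> rdiv x\<^sub>3 x\<^sub>2 \<in> S\<^sub>1"
    and ldiv_closed: "\<lbrakk>x\<^sub>1 \<in> S\<^sub>1; x\<^sub>3 \<in> S\<^sub>3\<rbrakk> \<Longrightarrow> ldiv x\<^sub>1 x\<^sub>3 \<in> S\<^sub>2"
    and ldiv_mul: "\<lbrakk>x\<^sub>1 \<in> S\<^sub>1; x\<^sub>2 \<in> S\<^sub>2\<rbrakk> \<Longrightarrow> ldiv x\<^sub>1 (mul x\<^sub>1 x\<^sub>2) = x\<^sub>2"
    and rdiv_mul: "\<lbrakk>x\<^sub>1 \<in> S\<^sub>1; x\<^sub>2 \<in> S\<^sub>2\<rbrakk> \<Longrightarrow> x\<^sub>1 = rdiv (mul x\<^sub>1 x\<^sub>2) x\<^sub>2"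
    and mul_ldiv: "\<lbrakk>x\<^sub>1 \<in> S\<^sub>1; x\<^sub>3 \<in> S\<^sub>3\<rbrakk> \<Longrightarrow> mul x\<^sub>1 (ldiv x\<^sub>1 x\<^sub>3) = x\<^sub>3"
    and mul_rdiv: "\<lbrakk>x\<^sub>3 \<in> S\<^sub>3; x\<^sub>2 \<in> S\<^sub>2\<rbrakk> \<Longrightarrow> x\<^sub>3 = mul (rdiv x\<^sub>3 x\<^sub>2) x\<^sub>2"

locale quasigroup =
  fixes Q :: "'q set"
    and mul :: "'q \<Rightarrow> 'q \<Rightarrow> 'q"
    and rdiv :: "'q \<Rightarrow> 'q \<Rightarrow> 'q"
    and ldiv :: "'q \<Rightarrow> 'q \<Rightarrow> 'q"
  assumes mul_closed: "\<lbrakk>x \<in> Q; y \<in> Q\<rbrakk> \<Longrightarrow> mul x y \<in> Q"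
    and rdiv_closed: "\<lbrakk>x \<in> Q; y \<in> Q\<rbrakk> \<Longrightarrow> rdiv x y \<in> Q"
    and ldiv_closed: "\<lbrakk>x \<in> Q; y \<in> Q\<rbrakk> \<Longrightarrow> ldiv x y \<in> Q"
    and mul_ldiv: "\<lbrakk>x \<in> Q; y \<in> Q\<rbrakk> \<Longrightarrow> mul x (ldiv x y) = y"
    and mul_rdiv: "\<lbrakk>x \<in> Q; y \<in> Q\<rbrakk> \<Longrightarrow> y = mul (rdiv y x) x"
    and ldiv_mul: "\<lbrakk>x \<in> Q; y \<in> Q\<rbrakk> \<Longrightarrow> ldiv x (mul x y) = y"
    and rdiv_mul: "\<lbrakk>x \<in> Q; y \<in> Q\<rbrakk> \<Longrightarrow> y = rdiv (mul y x) x"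

(* Isotopy involves only the multiplications, so the divisions are not arguments. *)
definition isotopic ::
  "'q set \<Rightarrow> ('q \<Rightarrow> 'q \<Rightarrow> 'q) \<Rightarrow> 'r set \<Rightarrow> ('r \<Rightarrow> 'r \<Rightarrow> 'r) \<Rightarrow> bool" where
  "isotopic Q mul Q' mul' \<longleftrightarrow>
     (\<exists>f\<^sub>1 f\<^sub>2 f\<^sub>3. bij_betw f\<^sub>1 Q Q' \<and> bij_betw f\<^sub>2 Q Q' \<and> bij_betw f\<^sub>3 Q Q' \<and>
        (\<forall>x\<in>Q. \<forall>y\<in>Q. mul' (f\<^sub>1 x) (f\<^sub>2 y) = f\<^sub>3 (mul x y)))"

(* The divisions of a quasigroup are determined by its multiplication, so a quasigroup presented
   by its multiplication alone is one for which suitable divisions exist. *)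
definition semisymmetric_quasigroup :: "'q set \<Rightarrow> ('q \<Rightarrow> 'q \<Rightarrow> 'q) \<Rightarrow> bool" where
  "semisymmetric_quasigroup Q mul \<longleftrightarrow>
     (\<exists>rdiv ldiv. quasigroup Q mul rdiv ldiv) \<and>
     (\<forall>x\<in>Q. \<forall>y\<in>Q. mul x (mul y x) = y)"

locale semisymmetrized_algebra =
  fixes P :: "'p set"
    and mul :: "'p \<Rightarrow> 'p \<Rightarrow> 'p"
    and \<alpha> :: "'p \<Rightarrow> 'p \<Rightarrow> 'p \<Rightarrow> 'p"
  assumes semisymmetric: "semisymmetric_quasigroup P mul"
    and alpha_closed: "\<lbrakk>x \<in> P; y \<in> P; z \<in> P\<rbrakk> \<Longrightarrow> \<alpha> x y z \<in> P"
    and alpha_idem: "x \<in> P \<Longrightarrow> \<alpha> x x x = x"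
    and alpha_diagonal:
      "\<lbrakk>x\<^sub>1\<^sub>1 \<in> P; x\<^sub>1\<^sub>2 \<in> P; x\<^sub>1\<^sub>3 \<in> P; x\<^sub>2\<^sub>1 \<in> P; x\<^sub>2\<^sub>2 \<in> P; x\<^sub>2\<^sub>3 \<in> P; x\<^sub>3\<^sub>1 \<in> P; x\<^sub>3\<^sub>2 \<in> P; x\<^sub>3\<^sub>3 \<in> P\<rbrakk>
        \<Longrightarrow> \<alpha> (\<alpha> x\<^sub>1\<^sub>1 x\<^sub>1\<^sub>2 x\<^sub>1\<^sub>3) (\<alpha> x\<^sub>2\<^sub>1 x\<^sub>2\<^sub>2 x\<^sub>2\<^sub>3) (\<alpha> x\<^sub>3\<^sub>1 x\<^sub>3\<^sub>2 x\<^sub>3\<^sub>3) = \<alpha> x\<^sub>1\<^sub>1 x\<^sub>2\<^sub>2 x\<^sub>3\<^sub>3"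
    and alpha_mul:
      "\<lbrakk>x\<^sub>1 \<in> P; x\<^sub>2 \<in> P; x\<^sub>3 \<in> P; y\<^sub>1 \<in> P; y\<^sub>2 \<in> P; y\<^sub>3 \<in> P\<rbrakk>
        \<Longrightarrow> \<alpha> (mul x\<^sub>1 y\<^sub>1) (mul x\<^sub>2 y\<^sub>2) (mul x\<^sub>3 y\<^sub>3) = mul (\<alpha> x\<^sub>3 x\<^sub>1 x\<^sub>2) (\<alpha> y\<^sub>2 y\<^sub>3 y\<^sub>1)"

definition isomorphic_semisymmetrized ::
  "'p set \<Rightarrow> ('p \<Rightarrow> 'p \<Rightarrow> 'p) \<Rightarrow> ('p \<Rightarrow> 'p \<Rightarrow> 'p \<Rightarrow> 'p) \<Rightarrow>
   'q set \<Rightarrow> ('q \<Rightarrow> 'q \<Rightarrow> 'q) \<Rightarrow> ('q \<Rightarrow> 'q \<Rightarrow> 'q \<Rightarrow> 'q) \<Rightarrow> bool" where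
  "isomorphic_semisymmetrized P mul \<alpha> P' mul' \<alpha>' \<longleftrightarrow>
     (\<exists>f. bij_betw f P P' \<and>
        (\<forall>x\<in>P. \<forall>y\<in>P. f (mul x y) = mul' (f x) (f y)) \<and>
        (\<forall>x\<in>P. \<forall>y\<in>P. \<forall>z\<in>P. f (\<alpha> x y z) = \<alpha>' (f x) (f y) (f z)))"

definition opposite :: "('q \<Rightarrow> 'q \<Rightarrow> 'q) \<Rightarrow> 'q \<Rightarrow> 'q \<Rightarrow> 'q" where
  "opposite f x y = f y x"

abbreviation semisym_carrier :: "'q set \<Rightarrow> ('q \<times> 'q \<times> 'q) set" where
  "semisym_carrier Q \<equiv> Q \<times> Q \<times> Q"

(* opposite rdiv and opposite ldiv are the operations x // y = y / x and its left-handed analogue. *)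
fun semisym_mul ::
  "('q \<Rightarrow> 'q \<Rightarrow> 'q) \<Rightarrow> ('q \<Rightarrow> 'q \<Rightarrow> 'q) \<Rightarrow> ('q \<Rightarrow> 'q \<Rightarrow> 'q) \<Rightarrow>
   'q \<times> 'q \<times> 'q \<Rightarrow> 'q \<times> 'q \<times> 'q \<Rightarrow> 'q \<times> 'q \<times> 'q" where
  "semisym_mul mul rdiv ldiv (x\<^sub>1, x\<^sub>2, x\<^sub>3) (y\<^sub>1, y\<^sub>2, y\<^sub>3) =
     (opposite rdiv x\<^sub>2 y\<^sub>3, opposite ldiv x\<^sub>3 y\<^sub>1, mul x\<^sub>1 y\<^sub>2)"

fun semisym_alpha ::
  "'q \<times> 'q \<times> 'q \<Rightarrow> 'q \<times> 'q \<times> 'q \<Rightarrow> 'q \<times> 'q \<times> 'q \<Rightarrow> 'q \<times> 'q \<times> 'q" where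
  "semisym_alpha (x\<^sub>1, x\<^sub>2, x\<^sub>3) (y\<^sub>1, y\<^sub>2, y\<^sub>3) (z\<^sub>1, z\<^sub>2, z\<^sub>3) = (x\<^sub>1, y\<^sub>2, z\<^sub>3)"

end

theory Submission
  imports Defs
begin

text \<open>
  Since \<open>\<lambda> = \<rho>\<^sup>-\<^sup>1 = -\<rho>\<^sup>2\<close>, everything can be written in terms of \<open>\<rho>\<close>, and the automaton axioms come
  down to \<open>\<lambda> + \<rho>\<^sup>2 = 0\<close> and \<open>\<lambda>\<^sup>2 + \<rho> = 0\<close>.  Because \<open>\<rho>\<close> carries \<open>S\<^sub>3\<close> to \<open>S\<^sub>2\<close> and \<open>S\<^sub>2\<close> to \<open>S\<^sub>1\<close>,
  an isomorphism \<open>k\<close> from \<open>S\<^sub>1\<close> to \<open>A\<close> gives coordinates \<open>x \<mapsto> (k (a\<^sub>1 x), k (\<rho> (a\<^sub>2 x)), k (\<rho>\<^sup>2 (a\<^sub>3 x)))\<close>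
  on \<open>P\<close>, and in these the product of \<open>P\<close> is the semisymmetrization of the quasigroup
  \<open>x \<cdot> y = y - x\<close> on \<open>A\<close>, which is isotopic to \<open>A\<close> through negation of the first argument.
\<close>

section \<open>The quasigroup y - x on an abelian group\<close>

lemma (in comm_group) mult_inv_cancel:
  assumes "x \<in> carrier G" "y \<in> carrier G"
  shows "x \<otimes> (inv x \<otimes> y) = y" "inv x \<otimes> (x \<otimes> y) = y"
    "x \<otimes> (y \<otimes> inv x) = y" "inv x \<otimes> (y \<otimes> x) = y"
    "(y \<otimes> x) \<otimes> inv x = y" "(y \<otimes> inv x) \<otimes> x = y"
    "(x \<otimes> y) \<otimes> inv x = y" "(inv x \<otimes> y) \<otimes> x = y"
proof -
  show 1: "x \<otimes> (inv x \<otimes> y) = y" "inv x \<otimes> (x \<otimes> y) = y"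
    using assms by (simp_all flip: m_assoc)
  show "x \<otimes> (y \<otimes> inv x) = y" "inv x \<otimes> (y \<otimes> x) = y"
    "(y \<otimes> x) \<otimes> inv x = y" "(y \<otimes> inv x) \<otimes> x = y"
    "(x \<otimes> y) \<otimes> inv x = y" "(inv x \<otimes> y) \<otimes> x = y"
    using assms 1 by (simp_all add: m_ac)
qed

text \<open>Solving z = y - x for y gives the left division x + z, and solving it for x gives the
  right division y - z.\<close>

lemma (in comm_group) quasigroup_inv_mult:
  "quasigroup (carrier G) (\<lambda>x y. inv x \<otimes> y) (\<lambda>x y. y \<otimes> inv x) (\<lambda>x y. x \<otimes> y)"
  by unfold_locales (simp_all add: inv_mult_group mult_inv_cancel)

lemma (in comm_group) isotopic_inv_mult:
  "isotopic (carrier G) (\<lambda>x y. inv x \<otimes> y) (carrier G) (\<otimes>)"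
  unfolding isotopic_def
proof (intro exI conjI)
  \<comment> \<open>The first component of the isotopy is inversion; the other two are left
    schematic here and become identity maps below.\<close>
  show "bij_betw (m_inv G) (carrier G) (carrier G)"
    by (rule bij_betw_byWitness[where f' = "m_inv G"]) auto
qed (auto intro: bij_betw_id[unfolded id_def])

section \<open>The hypotheses as rewrite rules, free of inverse maps\<close>

locale cyclic_idempotents = comm_group P for P :: "('p, 'm) monoid_scheme" (structure) +
  fixes \<rho> lam a\<^sub>1 a\<^sub>2 a\<^sub>3 :: "'p \<Rightarrow> 'p"
  assumes rho_hom: "\<rho> \<in> hom P P"
    and a1_hom: "a\<^sub>1 \<in> hom P P" and a2_hom: "a\<^sub>2 \<in> hom P P" and a3_hom: "a\<^sub>3 \<in> hom P P"
    and idem: "complete_orthogonal_idempotents P a\<^sub>1 a\<^sub>2 a\<^sub>3"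
    and lam_eq: "x \<in> carrier P \<Longrightarrow> lam x = inv (\<rho> (\<rho> x))"
    and rho_cubed: "x \<in> carrier P \<Longrightarrow> \<rho> (\<rho> (\<rho> x)) = inv x"
    and a1_rho: "x \<in> carrier P \<Longrightarrow> a\<^sub>1 (\<rho> x) = \<rho> (a\<^sub>2 x)"
    and a2_rho: "x \<in> carrier P \<Longrightarrow> a\<^sub>2 (\<rho> x) = \<rho> (a\<^sub>3 x)"
    and a3_rho: "x \<in> carrier P \<Longrightarrow> a\<^sub>3 (\<rho> x) = \<rho> (a\<^sub>1 x)"
begin

lemma endo_closed [simp]:
  assumes "x \<in> carrier P"
  shows "\<rho> x \<in> carrier P" "a\<^sub>1 x \<in> carrier P" "a\<^sub>2 x \<in> carrier P" "a\<^sub>3 x \<in> carrier P"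
  using assms rho_hom a1_hom a2_hom a3_hom by (auto simp: hom_def)

lemma endo_mult [simp]:
  assumes "x \<in> carrier P" "y \<in> carrier P"
  shows "\<rho> (x \<otimes> y) = \<rho> x \<otimes> \<rho> y" "a\<^sub>1 (x \<otimes> y) = a\<^sub>1 x \<otimes> a\<^sub>1 y"
    "a\<^sub>2 (x \<otimes> y) = a\<^sub>2 x \<otimes> a\<^sub>2 y" "a\<^sub>3 (x \<otimes> y) = a\<^sub>3 x \<otimes> a\<^sub>3 y"
  using assms rho_hom a1_hom a2_hom a3_hom by (auto simp: hom_def)

lemma endo_one [simp]: "\<rho> \<one> = \<one>" "a\<^sub>1 \<one> = \<one>" "a\<^sub>2 \<one> = \<one>" "a\<^sub>3 \<one> = \<one>"
  using rho_hom a1_hom a2_hom a3_hom by (auto intro: hom_one is_group)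

lemma endo_inv [simp]:
  assumes "x \<in> carrier P"
  shows "\<rho> (inv x) = inv (\<rho> x)" "a\<^sub>1 (inv x) = inv (a\<^sub>1 x)"
    "a\<^sub>2 (inv x) = inv (a\<^sub>2 x)" "a\<^sub>3 (inv x) = inv (a\<^sub>3 x)"
  using assms rho_hom a1_hom a2_hom a3_hom
  by (auto intro!: group_hom.hom_inv group_hom.intro group_hom_axioms.intro is_group)

lemma idem_simps [simp]:
  assumes "x \<in> carrier P"
  shows "a\<^sub>1 (a\<^sub>1 x) = a\<^sub>1 x" "a\<^sub>2 (a\<^sub>2 x) = a\<^sub>2 x" "a\<^sub>3 (a\<^sub>3 x) = a\<^sub>3 x"
    "a\<^sub>1 (a\<^sub>2 x) = \<one>" "a\<^sub>1 (a\<^sub>3 x) = \<one>" "a\<^sub>2 (a\<^sub>1 x) = \<one>"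
    "a\<^sub>2 (a\<^sub>3 x) = \<one>" "a\<^sub>3 (a\<^sub>1 x) = \<one>" "a\<^sub>3 (a\<^sub>2 x) = \<one>"
  using assms idem by (auto simp: complete_orthogonal_idempotents_def)

lemma idem_sum: "x \<in> carrier P \<Longrightarrow> a\<^sub>1 x \<otimes> a\<^sub>2 x \<otimes> a\<^sub>3 x = x"
  using idem by (auto simp: complete_orthogonal_idempotents_def)

text \<open>As rewrite rules these eliminate \<open>lam\<close>, push the idempotents inward past
  \<open>\<rho>\<close> and collapse cubes of \<open>\<rho>\<close>. Together with the simp rules
  above, every element becomes a product of terms \<open>\<rho>\<close>^j (\<open>a\<^sub>i\<close>
  x) with j \<le> 2 and their inverses.\<close>

lemmas rho_simps = lam_eq rho_cubed a1_rho a2_rho a3_rho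

section \<open>The subgroups S_i and the restrictions of \<open>\<rho>\<close> to them\<close>

lemma idempotent_image:
  assumes "a \<in> hom P P" "\<And>x. x \<in> carrier P \<Longrightarrow> a (a x) = a x"
  shows "x \<in> a ` carrier P \<longleftrightarrow> x \<in> carrier P \<and> a x = x"
  using assms by (force simp: hom_def image_iff)

text \<open>Membership in S_i turns into a fixed-point equation for \<open>a\<^sub>i\<close>, which
  \<open>rho_simps\<close> can decide.\<close>

lemmas image_iffs =
  idempotent_image[OF a1_hom idem_simps(1)]
  idempotent_image[OF a2_hom idem_simps(2)]
  idempotent_image[OF a3_hom idem_simps(3)]

lemma image_subgroup: "a \<in> hom P P \<Longrightarrow> subgroup (a ` carrier P) P"
  by (auto intro!: group_hom.img_is_subgroup group_hom.intro group_hom_axioms.intro is_group)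

text \<open>The intertwining \<open>ba\<close> makes \<open>\<rho>\<close> send fixed points of
  \<open>a\<close> to fixed points of \<open>b\<close>, and \<open>lam\<close>, the inverse of
  \<open>\<rho>\<close>, sends them back.\<close>

lemma rho_bij_betw_images:
  assumes a: "a \<in> hom P P" "\<And>x. x \<in> carrier P \<Longrightarrow> a (a x) = a x"
    and b: "b \<in> hom P P" "\<And>x. x \<in> carrier P \<Longrightarrow> b (b x) = b x"
    and ba: "\<And>x. x \<in> carrier P \<Longrightarrow> b (\<rho> x) = \<rho> (a x)"
  shows "bij_betw \<rho> (a ` carrier P) (b ` carrier P)"
proof (rule bij_betw_byWitness[where f' = lam])
  have imgs: "x \<in> a ` carrier P \<longleftrightarrow> x \<in> carrier P \<and> a x = x"
    "x \<in> b ` carrier P \<longleftrightarrow> x \<in> carrier P \<and> b x = x" for x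
    by (rule idempotent_image; fact a b)+
  show "\<forall>x\<in>a ` carrier P. lam (\<rho> x) = x" "\<forall>y\<in>b ` carrier P. \<rho> (lam y) = y"
    unfolding Ball_def imgs by (simp_all add: lam_eq rho_cubed)
  show "\<rho> ` a ` carrier P \<subseteq> b ` carrier P"
    unfolding image_subset_iff[of \<rho>] Ball_def imgs using ba by simp
  \<comment> \<open>Since \<open>ba\<close> speaks only of values at \<open>\<rho> x\<close>, it is
    used at x = \<open>lam y\<close>, and the outer \<open>\<rho>\<close> is then removed by
    applying \<open>lam\<close>.\<close>
  have "a (lam y) = lam y" if y: "y \<in> carrier P" "b y = y" for y
  proof -
    have "\<rho> (a (lam y)) = b (\<rho> (lam y))" using ba[of "lam y"] y by (simp add: lam_eq)
    also have "\<dots> = y" using y by (simp add: lam_eq rho_cubed)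
    finally have "lam (\<rho> (a (lam y))) = lam y" by simp
    moreover have "a (lam y) \<in> carrier P" using a(1) y by (simp add: lam_eq hom_in_carrier)
    ultimately show ?thesis by (simp add: lam_eq[of "\<rho> _"] rho_cubed)
  qed
  then show "lam ` b ` carrier P \<subseteq> a ` carrier P"
    unfolding image_subset_iff[of lam] Ball_def imgs by (simp add: lam_eq)
qed

lemma restrict_rho_iso:
  assumes bij: "bij_betw \<rho> S T" and S: "S \<subseteq> carrier P"
    and closed: "\<And>x y. x \<in> S \<Longrightarrow> y \<in> S \<Longrightarrow> x \<otimes> y \<in> S"
  shows "restrict \<rho> S \<in> iso (P\<lparr>carrier := S\<rparr>) (P\<lparr>carrier := T\<rparr>)"
  using assms by (auto simp: iso_def hom_def bij_betw_def subset_iff)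

text \<open>If y = \<open>\<rho> x\<close> then inv (\<open>\<rho> (\<rho> y)\<close>) is the
  inverse of the cube of \<open>\<rho>\<close> at x, hence x. So one formula, that of
  \<open>lam\<close>, serves for all three maps \<theta>_i^{-1}.\<close>

lemma inv_into_restrict_rho:
  assumes bij: "bij_betw \<rho> S T" and S: "S \<subseteq> carrier P" and y: "y \<in> T"
  shows "inv_into S (restrict \<rho> S) y = inv (\<rho> (\<rho> y))"
proof -
  obtain x where x: "x \<in> S" "y = \<rho> x" using bij y by (auto simp: bij_betw_def)
  have "inj_on (restrict \<rho> S) S" using bij by (simp add: bij_betw_def inj_on_def)
  then have "inv_into S (restrict \<rho> S) y = x" using x by (metis inv_into_f_f restrict_apply')
  also have "x = inv (\<rho> (\<rho> y))" using x S by (auto simp: rho_cubed)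
  finally show ?thesis .
qed

lemmas rho_bij =
  rho_bij_betw_images[OF a1_hom idem_simps(1) a3_hom idem_simps(3) a3_rho]
  rho_bij_betw_images[OF a2_hom idem_simps(2) a1_hom idem_simps(1) a1_rho]
  rho_bij_betw_images[OF a3_hom idem_simps(3) a2_hom idem_simps(2) a2_rho]

lemmas image_subgroups = a1_hom[THEN image_subgroup] a2_hom[THEN image_subgroup]
  a3_hom[THEN image_subgroup]

lemma rho_isos:
  "restrict \<rho> (a\<^sub>1 ` carrier P) \<in> iso (P\<lparr>carrier := a\<^sub>1 ` carrier P\<rparr>) (P\<lparr>carrier := a\<^sub>3 ` carrier P\<rparr>)"
  "restrict \<rho> (a\<^sub>2 ` carrier P) \<in> iso (P\<lparr>carrier := a\<^sub>2 ` carrier P\<rparr>) (P\<lparr>carrier := a\<^sub>1 ` carrier P\<rparr>)"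
  "restrict \<rho> (a\<^sub>3 ` carrier P) \<in> iso (P\<lparr>carrier := a\<^sub>3 ` carrier P\<rparr>) (P\<lparr>carrier := a\<^sub>2 ` carrier P\<rparr>)"
  by (intro restrict_rho_iso rho_bij image_subgroups[THEN subgroup.subset];
      simp add: image_subgroups[THEN subgroup.m_closed])+

section \<open>Part (a): the reversible automaton\<close>

lemma automaton:
  "reversible_automaton (a\<^sub>1 ` carrier P) (a\<^sub>2 ` carrier P) (a\<^sub>3 ` carrier P)
     (\<lambda>x\<^sub>1 y\<^sub>2. restrict \<rho> (a\<^sub>1 ` carrier P) x\<^sub>1
        \<otimes> inv_into (a\<^sub>3 ` carrier P) (restrict \<rho> (a\<^sub>3 ` carrier P)) y\<^sub>2)
     (\<lambda>y\<^sub>3 x\<^sub>2. inv_into (a\<^sub>1 ` carrier P) (restrict \<rho> (a\<^sub>1 ` carrier P)) y\<^sub>3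
        \<otimes> restrict \<rho> (a\<^sub>2 ` carrier P) x\<^sub>2)
     (\<lambda>y\<^sub>1 x\<^sub>3. inv_into (a\<^sub>2 ` carrier P) (restrict \<rho> (a\<^sub>2 ` carrier P)) y\<^sub>1
        \<otimes> restrict \<rho> (a\<^sub>3 ` carrier P) x\<^sub>3)"
  (is "reversible_automaton ?S\<^sub>1 ?S\<^sub>2 ?S\<^sub>3 ?mul ?rdiv ?ldiv")
proof -
  \<comment> \<open>The restricted maps have known values only on their domains, so these formulas
    need membership premises; the closure facts that follow supply them for nested
    operations.\<close>
  have mul: "?mul x y = \<rho> x \<otimes> inv (\<rho> (\<rho> y))" if "x \<in> ?S\<^sub>1" "y \<in> ?S\<^sub>2" for x y
    using that inv_into_restrict_rho[OF rho_bij(3)] a3_hom by (force simp: hom_def)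
  have rdiv: "?rdiv y x = inv (\<rho> (\<rho> y)) \<otimes> \<rho> x" if "y \<in> ?S\<^sub>3" "x \<in> ?S\<^sub>2" for x y
    using that inv_into_restrict_rho[OF rho_bij(1)] a1_hom by (force simp: hom_def)
  have ldiv: "?ldiv y x = inv (\<rho> (\<rho> y)) \<otimes> \<rho> x" if "y \<in> ?S\<^sub>1" "x \<in> ?S\<^sub>3" for x y
    using that inv_into_restrict_rho[OF rho_bij(2)] a2_hom by (force simp: hom_def)
  have mul_closed: "?mul x y \<in> ?S\<^sub>3" if "x \<in> ?S\<^sub>1" "y \<in> ?S\<^sub>2" for x y
    unfolding mul[OF that] using that by (simp add: image_iffs rho_simps)
  have rdiv_closed: "?rdiv y x \<in> ?S\<^sub>1" if "y \<in> ?S\<^sub>3" "x \<in> ?S\<^sub>2" for x y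
    unfolding rdiv[OF that] using that by (simp add: image_iffs rho_simps)
  have ldiv_closed: "?ldiv y x \<in> ?S\<^sub>2" if "y \<in> ?S\<^sub>1" "x \<in> ?S\<^sub>3" for x y
    unfolding ldiv[OF that] using that by (simp add: image_iffs rho_simps)
  show ?thesis
  proof
    fix x y assume xy: "x \<in> ?S\<^sub>1" "y \<in> ?S\<^sub>2"
    show "?ldiv x (?mul x y) = y"
      \<comment> \<open>The outer operation is expanded first, because \<open>mul_closed\<close>
        speaks of the inner product in its unexpanded form.\<close>
      unfolding ldiv[OF xy(1) mul_closed[OF xy]] unfolding mul[OF xy]
      using xy by (simp add: image_iffs rho_simps mult_inv_cancel)
    show "x = ?rdiv (?mul x y) y"
      unfolding rdiv[OF mul_closed[OF xy] xy(2)] unfolding mul[OF xy]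
      using xy by (simp add: image_iffs rho_simps inv_mult_group mult_inv_cancel)
  next
    fix x z assume xz: "x \<in> ?S\<^sub>1" "z \<in> ?S\<^sub>3"
    show "?mul x (?ldiv x z) = z"
      unfolding mul[OF xz(1) ldiv_closed[OF xz]] unfolding ldiv[OF xz]
      using xz by (simp add: image_iffs rho_simps inv_mult_group mult_inv_cancel)
  next
    fix z y assume zy: "z \<in> ?S\<^sub>3" "y \<in> ?S\<^sub>2"
    show "z = ?mul (?rdiv z y) y"
      unfolding mul[OF rdiv_closed[OF zy] zy(2)] unfolding rdiv[OF zy]
      using zy by (simp add: image_iffs rho_simps mult_inv_cancel)
  qed (fact mul_closed rdiv_closed ldiv_closed)+
qed

section \<open>Part (b): the semisymmetrized algebra on P\<close>

lemma semisymmetrized: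
  "semisymmetrized_algebra (carrier P)
     (\<lambda>x y. \<rho> x \<otimes> lam y) (\<lambda>x\<^sub>1 x\<^sub>2 x\<^sub>3. a\<^sub>1 x\<^sub>1 \<otimes> a\<^sub>2 x\<^sub>2 \<otimes> a\<^sub>3 x\<^sub>3)"
proof
  \<comment> \<open>In a semisymmetric quasigroup both divisions are the opposite of the
    multiplication.\<close>
  have "quasigroup (carrier P) (\<lambda>x y. \<rho> x \<otimes> lam y) (\<lambda>x y. \<rho> y \<otimes> lam x) (\<lambda>x y. \<rho> y \<otimes> lam x)"
    by unfold_locales (simp_all add: rho_simps inv_mult_group mult_inv_cancel)
  then show "semisymmetric_quasigroup (carrier P) (\<lambda>x y. \<rho> x \<otimes> lam y)"
    unfolding semisymmetric_quasigroup_def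
    by (auto simp: rho_simps inv_mult_group mult_inv_cancel)
next
  show "a\<^sub>1 x \<otimes> a\<^sub>2 x \<otimes> a\<^sub>3 x = x" if "x \<in> carrier P" for x
    using that by (rule idem_sum)
next
  fix x\<^sub>1 x\<^sub>2 x\<^sub>3 y\<^sub>1 y\<^sub>2 y\<^sub>3
  assume "x\<^sub>1 \<in> carrier P" "x\<^sub>2 \<in> carrier P" "x\<^sub>3 \<in> carrier P"
    and "y\<^sub>1 \<in> carrier P" "y\<^sub>2 \<in> carrier P" "y\<^sub>3 \<in> carrier P"
  \<comment> \<open>This is the rearrangement left after normalisation: p, r, t come from the x's
    and q, s, u from the y's. The order q, u, s arises because \<open>inv_mult_group\<close>
    reverses products.\<close>
  moreover have "p \<otimes> q \<otimes> (r \<otimes> s) \<otimes> (t \<otimes> u) = t \<otimes> p \<otimes> r \<otimes> (q \<otimes> (u \<otimes> s))"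
    if "p \<in> carrier P" "q \<in> carrier P" "r \<in> carrier P"
      "s \<in> carrier P" "t \<in> carrier P" "u \<in> carrier P" for p q r s t u
    using that by (simp add: m_ac)
  ultimately show "a\<^sub>1 (\<rho> x\<^sub>1 \<otimes> lam y\<^sub>1) \<otimes> a\<^sub>2 (\<rho> x\<^sub>2 \<otimes> lam y\<^sub>2) \<otimes> a\<^sub>3 (\<rho> x\<^sub>3 \<otimes> lam y\<^sub>3) =
      \<rho> (a\<^sub>1 x\<^sub>3 \<otimes> a\<^sub>2 x\<^sub>1 \<otimes> a\<^sub>3 x\<^sub>2) \<otimes> lam (a\<^sub>1 y\<^sub>2 \<otimes> a\<^sub>2 y\<^sub>3 \<otimes> a\<^sub>3 y\<^sub>1)"
    by (simp add: rho_simps inv_mult_group)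
qed simp_all

section \<open>Part (b): coordinates in A and the isomorphism\<close>

definition coordinates :: "('p \<Rightarrow> 'b) \<Rightarrow> 'p \<Rightarrow> 'b \<times> 'b \<times> 'b" where
  "coordinates k x = (k (a\<^sub>1 x), k (\<rho> (a\<^sub>2 x)), k (\<rho> (\<rho> (a\<^sub>3 x))))"

lemma coordinates_mem:
  assumes "x \<in> carrier P"
  shows "a\<^sub>1 x \<in> a\<^sub>1 ` carrier P" "\<rho> (a\<^sub>2 x) \<in> a\<^sub>1 ` carrier P" "\<rho> (\<rho> (a\<^sub>3 x)) \<in> a\<^sub>1 ` carrier P"
  using assms by (simp_all add: image_iffs rho_simps)

lemma coordinates_bij:
  assumes k: "bij_betw k (a\<^sub>1 ` carrier P) B"
  shows "bij_betw (coordinates k) (carrier P) (B \<times> B \<times> B)"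
proof -
  let ?S = "a\<^sub>1 ` carrier P"
  let ?h = "inv_into ?S k"
  have h: "?h u \<in> carrier P" "a\<^sub>1 (?h u) = ?h u" "k (?h u) = u" if "u \<in> B" for u
    using bij_betw_apply[OF bij_betw_inv_into[OF k] that] bij_betw_inv_into_right[OF k that]
    by (auto simp: image_iffs)
  have a23: "a\<^sub>2 (?h u) = \<one>" "a\<^sub>3 (?h u) = \<one>" if "u \<in> B" for u
    using h[OF that] idem_simps(6,8)[of "?h u"] by simp_all
  have k_mem: "k s \<in> B" "?h (k s) = s" if "s \<in> ?S" for s
    using bij_betw_apply[OF k that] bij_betw_inv_into_left[OF k that] by simp_all
  show ?thesis
  \<comment> \<open>The inverse returns the coordinates from S_1 to S_1, S_2 and S_3 by the powers
    0, -1 and -2 of \<open>\<rho>\<close>. As the cube of \<open>\<rho>\<close> is inversion, these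
    are the identity, -\<rho>^2 and -\<rho>.\<close>
  proof (rule bij_betw_byWitness[where
        f' = "\<lambda>(u, v, w). ?h u \<otimes> inv (\<rho> (\<rho> (?h v))) \<otimes> inv (\<rho> (?h w))"])
    show "\<forall>x\<in>carrier P. (case coordinates k x of (u, v, w) \<Rightarrow>
        ?h u \<otimes> inv (\<rho> (\<rho> (?h v))) \<otimes> inv (\<rho> (?h w))) = x"
      by (simp add: coordinates_def k_mem coordinates_mem rho_cubed idem_sum)
    show "\<forall>t\<in>B \<times> B \<times> B. coordinates k (case t of (u, v, w) \<Rightarrow>
        ?h u \<otimes> inv (\<rho> (\<rho> (?h v))) \<otimes> inv (\<rho> (?h w))) = t"
      by (auto simp: coordinates_def h a23 rho_simps)
  qed (auto simp: coordinates_def h k_mem coordinates_mem)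
qed

text \<open>With coordinates (x_1, x_2, x_3) and (y_1, y_2, y_3), the product of P has coordinates
  (x_2 - y_3, x_3 + y_1, y_2 - x_1). The changed signs at y_1 and x_1, and the lowered power of
  \<open>\<rho>\<close> at y_2, come from the cube of \<open>\<rho>\<close> being inversion.\<close>

lemma isomorphic_semisymmetrization:
  assumes A: "comm_group A" and k: "k \<in> iso (P\<lparr>carrier := a\<^sub>1 ` carrier P\<rparr>) A"
  shows "isomorphic_semisymmetrized (carrier P)
     (\<lambda>x y. \<rho> x \<otimes> lam y) (\<lambda>x\<^sub>1 x\<^sub>2 x\<^sub>3. a\<^sub>1 x\<^sub>1 \<otimes> a\<^sub>2 x\<^sub>2 \<otimes> a\<^sub>3 x\<^sub>3)
     (semisym_carrier (carrier A))
     (semisym_mul (\<lambda>x y. inv\<^bsub>A\<^esub> x \<otimes>\<^bsub>A\<^esub> y) (\<lambda>x y. y \<otimes>\<^bsub>A\<^esub> inv\<^bsub>A\<^esub> x) (\<lambda>x y. x \<otimes>\<^bsub>A\<^esub> y))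
     semisym_alpha"
proof -
  interpret A: comm_group A by (fact A)
  let ?S = "a\<^sub>1 ` carrier P"
  interpret S: subgroup ?S P by (rule image_subgroups(1))
  have k_mult: "k (x \<otimes> y) = k x \<otimes>\<^bsub>A\<^esub> k y" if "x \<in> ?S" "y \<in> ?S" for x y
    using k that by (auto simp: iso_def hom_def)
  have k_closed: "k x \<in> carrier A" if "x \<in> ?S" for x
    using k that by (auto simp: iso_def hom_def)
  have k_one: "k \<one> = \<one>\<^bsub>A\<^esub>"
    \<comment> \<open>The image of the identity is idempotent in the group A, so it is the
      identity.\<close>
    using k_mult[of \<one> \<one>] k_closed[of \<one>] by simp
  have k_inv: "k (inv x) = inv\<^bsub>A\<^esub> k x" if x: "x \<in> ?S" for x
  proof (rule A.inv_equality[symmetric])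
    show "k (inv x) \<otimes>\<^bsub>A\<^esub> k x = \<one>\<^bsub>A\<^esub>"
      using k_mult[of "inv x" x] k_one x by simp
  qed (use x k_closed in auto)
  have "bij_betw (coordinates k) (carrier P) (semisym_carrier (carrier A))"
    using k by (intro coordinates_bij) (simp add: iso_def)
  moreover have "coordinates k (\<rho> x \<otimes> lam y) =
      semisym_mul (\<lambda>x y. inv\<^bsub>A\<^esub> x \<otimes>\<^bsub>A\<^esub> y) (\<lambda>x y. y \<otimes>\<^bsub>A\<^esub> inv\<^bsub>A\<^esub> x) (\<lambda>x y. x \<otimes>\<^bsub>A\<^esub> y)
        (coordinates k x) (coordinates k y)"
    if "x \<in> carrier P" "y \<in> carrier P" for x y
    using that
    by (simp add: coordinates_def opposite_def rho_simps k_mult k_inv k_closed coordinates_mem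
        A.m_comm)
  moreover have "coordinates k (a\<^sub>1 x \<otimes> a\<^sub>2 y \<otimes> a\<^sub>3 z) =
      semisym_alpha (coordinates k x) (coordinates k y) (coordinates k z)"
    if "x \<in> carrier P" "y \<in> carrier P" "z \<in> carrier P" for x y z
    using that by (simp add: coordinates_def)
  ultimately show ?thesis
    unfolding isomorphic_semisymmetrized_def by blast
qed

end

section \<open>Reduction of the stated hypotheses to the rewrite rules\<close>

theorem theorem6p5:
  fixes P :: "('p, 'm) monoid_scheme" (structure)
    and \<rho> lam a\<^sub>1 a\<^sub>2 a\<^sub>3 :: "'p \<Rightarrow> 'p"
    and S\<^sub>1 S\<^sub>2 S\<^sub>3 :: "'p set"
    and \<theta>\<^sub>1 \<theta>\<^sub>2 \<theta>\<^sub>3 :: "'p \<Rightarrow> 'p"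
    and A :: "('b, 'n) monoid_scheme"
  assumes P: "comm_group P"
    and endo: "\<rho> \<in> hom P P" "lam \<in> hom P P" "a\<^sub>1 \<in> hom P P" "a\<^sub>2 \<in> hom P P" "a\<^sub>3 \<in> hom P P"
    and idem: "complete_orthogonal_idempotents P a\<^sub>1 a\<^sub>2 a\<^sub>3"
    and rho_lambda: "\<And>x. x \<in> carrier P \<Longrightarrow> lam (\<rho> x) = x"
    and lambda_rho: "\<And>x. x \<in> carrier P \<Longrightarrow> \<rho> (lam x) = x"
    and rho_cubed: "\<And>x. x \<in> carrier P \<Longrightarrow> inv (\<rho> (\<rho> (\<rho> x))) = x"
    and conj: "\<And>x. x \<in> carrier P \<Longrightarrow> a\<^sub>1 x = conj_by (carrier P) \<rho> a\<^sub>2 x"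
      "\<And>x. x \<in> carrier P \<Longrightarrow> a\<^sub>2 x = conj_by (carrier P) \<rho> a\<^sub>3 x"
      "\<And>x. x \<in> carrier P \<Longrightarrow> a\<^sub>3 x = conj_by (carrier P) \<rho> a\<^sub>1 x"
    and S: "S\<^sub>1 = a\<^sub>1 ` carrier P" "S\<^sub>2 = a\<^sub>2 ` carrier P" "S\<^sub>3 = a\<^sub>3 ` carrier P"
    and theta: "\<theta>\<^sub>1 = restrict \<rho> S\<^sub>1" "\<theta>\<^sub>2 = restrict \<rho> S\<^sub>2" "\<theta>\<^sub>3 = restrict \<rho> S\<^sub>3"
  shows
    "(subgroup S\<^sub>1 P \<and> subgroup S\<^sub>2 P \<and> subgroup S\<^sub>3 P \<and>
      \<theta>\<^sub>1 \<in> iso (P\<lparr>carrier := S\<^sub>1\<rparr>) (P\<lparr>carrier := S\<^sub>3\<rparr>) \<and>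
      \<theta>\<^sub>2 \<in> iso (P\<lparr>carrier := S\<^sub>2\<rparr>) (P\<lparr>carrier := S\<^sub>1\<rparr>) \<and>
      \<theta>\<^sub>3 \<in> iso (P\<lparr>carrier := S\<^sub>3\<rparr>) (P\<lparr>carrier := S\<^sub>2\<rparr>)) \<and>
     reversible_automaton S\<^sub>1 S\<^sub>2 S\<^sub>3
       (\<lambda>x\<^sub>1 y\<^sub>2. \<theta>\<^sub>1 x\<^sub>1 \<otimes> inv_into S\<^sub>3 \<theta>\<^sub>3 y\<^sub>2)
       (\<lambda>y\<^sub>3 x\<^sub>2. inv_into S\<^sub>1 \<theta>\<^sub>1 y\<^sub>3 \<otimes> \<theta>\<^sub>2 x\<^sub>2)
       (\<lambda>y\<^sub>1 x\<^sub>3. inv_into S\<^sub>2 \<theta>\<^sub>2 y\<^sub>1 \<otimes> \<theta>\<^sub>3 x\<^sub>3) \<and>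
     (comm_group A \<and> A \<cong> P\<lparr>carrier := S\<^sub>1\<rparr> \<and>
        P\<lparr>carrier := S\<^sub>1\<rparr> \<cong> P\<lparr>carrier := S\<^sub>2\<rparr> \<and> P\<lparr>carrier := S\<^sub>2\<rparr> \<cong> P\<lparr>carrier := S\<^sub>3\<rparr> \<longrightarrow>
      semisymmetrized_algebra (carrier P)
        (\<lambda>x y. \<rho> x \<otimes> lam y) (\<lambda>x\<^sub>1 x\<^sub>2 x\<^sub>3. a\<^sub>1 x\<^sub>1 \<otimes> a\<^sub>2 x\<^sub>2 \<otimes> a\<^sub>3 x\<^sub>3) \<and>
      (\<exists>(Q :: 'b set) mul rdiv ldiv.
         quasigroup Q mul rdiv ldiv \<and> isotopic Q mul (carrier A) (\<otimes>\<^bsub>A\<^esub>) \<and>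
         isomorphic_semisymmetrized (carrier P)
           (\<lambda>x y. \<rho> x \<otimes> lam y) (\<lambda>x\<^sub>1 x\<^sub>2 x\<^sub>3. a\<^sub>1 x\<^sub>1 \<otimes> a\<^sub>2 x\<^sub>2 \<otimes> a\<^sub>3 x\<^sub>3)
           (semisym_carrier Q) (semisym_mul mul rdiv ldiv) semisym_alpha))"
proof -
  interpret comm_group P by (fact P)
  have closed: "\<rho> x \<in> carrier P" "lam x \<in> carrier P" if "x \<in> carrier P" for x
    using endo that by (auto simp: hom_def)
  have cubed: "\<rho> (\<rho> (\<rho> x)) = inv x" if "x \<in> carrier P" for x
    using rho_cubed[OF that] closed that by (metis inv_inv)
  have lam: "lam x = inv (\<rho> (\<rho> x))" if "x \<in> carrier P" for x
    \<comment> \<open>At \<open>lam x\<close> the innermost of the three factors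
      \<open>\<rho>\<close> cancels.\<close>
    using rho_cubed[of "lam x"] lambda_rho closed that by metis
  have "inj_on \<rho> (carrier P)"
    by (metis inj_on_def rho_lambda)
  \<comment> \<open>Evaluating a conjugate at \<open>\<rho> x\<close> cancels the chosen inverse,
    which turns the conjugation hypotheses into the intertwining rules of the locale.\<close>
  then have conj_rho: "conj_by (carrier P) \<rho> a (\<rho> x) = \<rho> (a x)" if "x \<in> carrier P" for a x
    using that by (simp add: conj_by_def)
  interpret cyclic_idempotents P \<rho> lam a\<^sub>1 a\<^sub>2 a\<^sub>3
    by unfold_locales (use endo idem cubed lam conj closed conj_rho in auto)
  have "\<exists>(Q :: 'b set) mul rdiv ldiv.
         quasigroup Q mul rdiv ldiv \<and> isotopic Q mul (carrier A) (\<otimes>\<^bsub>A\<^esub>) \<and>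
         isomorphic_semisymmetrized (carrier P)
           (\<lambda>x y. \<rho> x \<otimes> lam y) (\<lambda>x\<^sub>1 x\<^sub>2 x\<^sub>3. a\<^sub>1 x\<^sub>1 \<otimes> a\<^sub>2 x\<^sub>2 \<otimes> a\<^sub>3 x\<^sub>3)
           (semisym_carrier Q) (semisym_mul mul rdiv ldiv) semisym_alpha"
    if A: "comm_group A" "A \<cong> P\<lparr>carrier := S\<^sub>1\<rparr>"
  proof -
    \<comment> \<open>The coordinates need a map into A, so the given isomorphism is reversed; the
      quasigroup is then y - x on the carrier of A itself.\<close>
    obtain k where "k \<in> iso (P\<lparr>carrier := S\<^sub>1\<rparr>) A"
      using group.iso_sym[OF comm_group.axioms(2)[OF A(1)] A(2)] by (auto simp: is_iso_def)
    then show ?thesis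
      using comm_group.quasigroup_inv_mult[OF A(1)] comm_group.isotopic_inv_mult[OF A(1)]
        isomorphic_semisymmetrization[OF A(1)] unfolding S by blast
  qed
  then show ?thesis
    using image_subgroups rho_isos automaton semisymmetrized unfolding S theta by blast
qed

end
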